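(* Let $p,n$ be positive integers with $p\ge n-1\ge 1$. Then $ex(p;K_{1,n-1})=\left\lfloor\frac{(n-2)p}{2}\right\rfloor$.
   Context: All graphs are finite simple graphs. $K_{1,n-1}$ is the star on $n$ vertices (one center adjacent to $n-1$ leaves). For a graph $L$, $ex(p;L)$ denotes the maximal number of edges in a graph on $p$ vertices that does not contain $L$ as a (not necessarily induced) subgraph. *)

theory Defs
  imports Complex_Main
begin

text \<open>A graph is a pair of a vertex set and a set of edges, an edge being the set of its two
  (distinct) end points.\<close>

type_synonym 'a graph = "'a set \<times> 'a set set"

abbreviation vertices :: "'a graph \<Rightarrow> 'a set" where
  "vertices G \<equiv> fst G"

abbreviation edges :: "'a graph \<Rightarrow> 'a set set" where
  "edges G \<equiv> snd G"

definition simple_graph :: "'a graph \<Rightarrow> bool" where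
  "simple_graph G \<longleftrightarrow> finite (vertices G) \<and> (\<forall>e\<in>edges G. e \<subseteq> vertices G \<and> card e = 2)"

definition subgraph :: "'a graph \<Rightarrow> 'a graph \<Rightarrow> bool" where
  "subgraph H G \<longleftrightarrow> simple_graph H \<and> simple_graph G \<and>
     vertices H \<subseteq> vertices G \<and> edges H \<subseteq> edges G"

definition isomorphic :: "'a graph \<Rightarrow> 'b graph \<Rightarrow> bool" where
  "isomorphic G H \<longleftrightarrow>
     (\<exists>f. bij_betw f (vertices G) (vertices H) \<and> edges H = (\<lambda>e. f ` e) ` edges G)"

text \<open>Containment is up to isomorphism and not necessarily induced.\<close>

definition contains :: "'a graph \<Rightarrow> 'b graph \<Rightarrow> bool" where
  "contains G L \<longleftrightarrow> (\<exists>H. subgraph H G \<and> isomorphic L H)"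

text \<open>Every finite graph has an isomorphic copy with natural numbers as vertices, so
  it suffices to let \<open>G\<close> range over those. The maximum is over a finite set of numbers; it is
  unspecified if every graph on \<open>p\<close> vertices contains \<open>L\<close>, i.e. if \<open>L\<close> has no edges and at
  most \<open>p\<close> vertices.\<close>

definition ex :: "nat \<Rightarrow> 'b graph \<Rightarrow> nat" where
  "ex p L = Max {card (edges G) | G :: nat graph.
     simple_graph G \<and> card (vertices G) = p \<and> \<not> contains G L}"

text \<open>\<open>star m\<close> is the complete bipartite graph \<open>K\<^bsub>1,m\<^esub>\<close>, with centre \<open>0\<close> and leaves \<open>1, \<dots>, m\<close>.\<close>

definition star :: "nat \<Rightarrow> nat graph" where
  "star m = ({0..m}, {{0, i} | i. i \<in> {1..m}})"

lemma simple_graph_star: "simple_graph (star m)"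
  by (auto simp: simple_graph_def star_def)

lemma simple_graph_card_edges_le:
  assumes "simple_graph G"
  shows "card (edges G) \<le> card (vertices G) choose 2"
proof -
  have "edges G \<subseteq> {e. e \<subseteq> vertices G \<and> card e = 2}"
    using assms by (auto simp: simple_graph_def)
  moreover have "finite {e. e \<subseteq> vertices G \<and> card e = 2}"
    using assms by (simp add: simple_graph_def)
  ultimately have "card (edges G) \<le> card {e. e \<subseteq> vertices G \<and> card e = 2}"
    by (rule card_mono[rotated])
  also have "\<dots> = card (vertices G) choose 2"
    using assms by (intro n_subsets) (simp add: simple_graph_def)
  finally show ?thesis .
qed

lemma finite_ex_set:
  "finite {card (edges G) | G :: nat graph.
     simple_graph G \<and> card (vertices G) = p \<and> \<not> contains G L}"
  by (rule finite_subset[of _ "{..p choose 2}"]) (auto dest: simple_graph_card_edges_le)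

end

theory Submission imports Defs begin

text \<open>A graph is free of the star with \<open>d + 1\<close> leaves iff all its degrees are at most \<open>d\<close>, so the
  handshake lemma gives the upper bound. It is attained by joining each residue modulo \<open>p\<close> to the
  \<open>d div 2\<close> residues following it and, for odd \<open>d\<close>, adding the matching that joins \<open>i\<close> and
  \<open>i + p div 2\<close> for \<open>i < p div 2\<close>.\<close>

section \<open>Degrees and containment of stars\<close>

definition degree :: "'a graph \<Rightarrow> 'a \<Rightarrow> nat" where
  "degree G v = card {e \<in> edges G. v \<in> e}"

lemma finite_edges:
  assumes "simple_graph G"
  shows "finite (edges G)"
proof (rule finite_subset)
  show "edges G \<subseteq> Pow (vertices G)" "finite (Pow (vertices G))"
    using assms by (auto simp: simple_graph_def)
qed

lemma sum_degree:
  assumes "simple_graph G"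
  shows "(\<Sum>v\<in>vertices G. degree G v) = 2 * card (edges G)"
proof -
  have fin: "finite (vertices G)"
    using assms by (simp add: simple_graph_def)
  have "card {v \<in> vertices G. v \<in> e} = 2" if "e \<in> edges G" for e
  proof -
    have "{v \<in> vertices G. v \<in> e} = e" "card e = 2"
      using assms that by (auto simp: simple_graph_def)
    then show ?thesis by simp
  qed
  then show ?thesis
    unfolding degree_def
    using sum_multicount[OF fin finite_edges[OF assms], of "\<lambda>v e. v \<in> e" 2]
    by (simp add: mult.commute)
qed

lemma vertices_star: "vertices (star m) = {0..m}"
  by (simp add: star_def)

lemma edges_star: "edges (star m) = (\<lambda>i. {0, i}) ` {1..m}"
  by (auto simp: star_def)

text \<open>An edge at \<open>v\<close> is determined by its other end. Hence the leaves of a star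
  copy centred at \<open>v\<close> give distinct edges at \<open>v\<close>, and conversely any
  \<open>m\<close> edges at \<open>v\<close> have \<open>m\<close> distinct other ends, which serve
  as leaves.\<close>

lemma contains_star_iff:
  fixes G :: "'a graph"
  assumes G: "simple_graph G"
  shows "contains G (star m) \<longleftrightarrow> (\<exists>v\<in>vertices G. m \<le> degree G v)"
proof
  assume "contains G (star m)"
  then obtain H f where H: "subgraph H G"
    and f: "bij_betw f {0..m} (vertices H)"
    and E: "edges H = (\<lambda>e. f ` e) ` (\<lambda>i. {0, i}) ` {1..m}"
    unfolding contains_def isomorphic_def vertices_star edges_star by blast
  have inj: "inj_on (\<lambda>i. {f 0, f i}) {1..m}"
  proof (rule inj_onI)
    fix i j assume ij: "i \<in> {1..m}" "j \<in> {1..m}" "{f 0, f i} = {f 0, f j}"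
    then have "f i = f j" by (auto simp: doubleton_eq_iff)
    with ij f show "i = j" by (auto simp: bij_betw_def inj_on_def)
  qed
  have "(\<lambda>i. {f 0, f i}) ` {1..m} \<subseteq> edges H"
    unfolding E by (simp add: image_image)
  then have "(\<lambda>i. {f 0, f i}) ` {1..m} \<subseteq> {e \<in> edges G. f 0 \<in> e}"
    using H by (auto simp: subgraph_def)
  then have "card ((\<lambda>i. {f 0, f i}) ` {1..m}) \<le> degree G (f 0)"
    unfolding degree_def by (intro card_mono) (simp_all add: finite_edges[OF G])
  then have "m \<le> degree G (f 0)"
    using inj by (simp add: card_image)
  moreover have "f 0 \<in> vertices G"
    using f H by (auto simp: bij_betw_def subgraph_def)
  ultimately show "\<exists>v\<in>vertices G. m \<le> degree G v" by blast
next
  assume "\<exists>v\<in>vertices G. m \<le> degree G v"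
  then obtain v where v: "v \<in> vertices G" and dv: "m \<le> card {e \<in> edges G. v \<in> e}"
    by (auto simp: degree_def)
  obtain S where S: "S \<subseteq> {e \<in> edges G. v \<in> e}" "card S = m" "finite S"
    using obtain_subset_with_card_n[OF dv] by blast
  then obtain g where g: "bij_betw g {1..m} S"
    using finite_same_card_bij[of "{1..m}" S] by auto
  have "\<exists>w. w \<noteq> v \<and> g i = {v, w}" if "i \<in> {1..m}" for i
  proof -
    have "g i \<in> edges G" "v \<in> g i"
      using g S that by (auto simp: bij_betw_def)
    with G have "card (g i) = 2" by (simp add: simple_graph_def)
    then obtain x y where "g i = {x, y}" "x \<noteq> y"
      unfolding card_2_iff by blast
    with \<open>v \<in> g i\<close> show ?thesis
      \<comment> \<open>The witness is the end of the edge other than \<open>v\<close>.\<close>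
      by (intro exI[of _ "if v = x then y else x"]) auto
  qed
  then obtain h where h: "\<And>i. i \<in> {1..m} \<Longrightarrow> h i \<noteq> v \<and> g i = {v, h i}"
    by metis
  \<comment> \<open>The value \<open>h 0\<close> is unspecified, so overwriting it with the centre
    \<open>v\<close> turns the choice of leaves into an embedding of the whole star.\<close>
  define f where "f = h(0 := v)"
  have f: "f 0 = v" "\<And>i. i \<in> {1..m} \<Longrightarrow> f i = h i"
    by (auto simp: f_def)
  have gE: "{v, h i} \<in> edges G" if "i \<in> {1..m}" for i
  proof -
    have "g i \<in> S" using g that by (auto simp: bij_betw_def)
    then show ?thesis using S(1) h[OF that] by auto
  qed
  have hV: "h i \<in> vertices G" if "i \<in> {1..m}" for i
    using gE[OF that] G by (auto simp: simple_graph_def)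
  have "inj_on h {1..m}"
  proof (rule inj_onI)
    fix i j assume ij: "i \<in> {1..m}" "j \<in> {1..m}" "h i = h j"
    then have "g i = g j" using h[OF ij(1)] h[OF ij(2)] by simp
    then show "i = j"
      using inj_onD[OF bij_betw_imp_inj_on[OF g]] ij by blast
  qed
  then have "inj_on f {1..m}"
    using f(2) inj_on_cong[of "{1..m}" f h] by blast
  moreover have "f 0 \<notin> f ` {1..m}"
    using h f by (metis imageE)
  ultimately have "inj_on f (insert 0 {1..m})"
    by simp
  moreover have "insert 0 {1..m} = {0..m}"
    by (simp add: atLeastAtMost_insertL)
  ultimately have inj: "inj_on f {0..m}"
    by (simp only:)
  define H where "H = (f ` {0..m}, (\<lambda>e. f ` e) ` edges (star m))"
  have HV: "vertices H \<subseteq> vertices G"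
    using v hV f by (auto simp: H_def f_def)
  have HE: "edges H = (\<lambda>i. {v, h i}) ` {1..m}"
    using f by (simp add: H_def edges_star image_image)
  then have HE': "edges H \<subseteq> edges G"
    using gE by auto
  have "simple_graph H"
    unfolding simple_graph_def
  proof (intro conjI ballI)
    show "finite (vertices H)" by (simp add: H_def)
    fix e assume e: "e \<in> edges H"
    then show "e \<subseteq> vertices H" by (auto simp: H_def edges_star)
    show "card e = 2" using e HE' G by (auto simp: simple_graph_def)
  qed
  then have "subgraph H G"
    using HV HE' G by (simp add: subgraph_def)
  moreover have "isomorphic (star m) H"
    unfolding isomorphic_def
    using inj by (intro exI[of _ f]) (simp add: H_def vertices_star bij_betw_def)
  ultimately show "contains G (star m)"
    unfolding contains_def by blast
qed

section \<open>Circulant graphs and the half-turn matching\<close>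

text \<open>\<open>(i + j) mod p\<close> for \<open>i < p\<close> and \<open>j \<le> p\<close>, written so that linear arithmetic applies.\<close>

definition cyc :: "nat \<Rightarrow> nat \<Rightarrow> nat \<Rightarrow> nat" where
  "cyc p i j = (if i + j < p then i + j else i + j - p)"

text \<open>The \<open>k\<close>-th power of the cycle on \<open>p\<close> residues. Only forward
  steps are listed; backward neighbours arise when the edge starts at its other end.\<close>

definition circulant_edges :: "nat \<Rightarrow> nat \<Rightarrow> nat set set" where
  "circulant_edges p k = (\<lambda>(i, j). {i, cyc p i j}) ` ({..<p} \<times> {1..k})"

text \<open>For even \<open>p\<close> this is a perfect matching by diameters. For odd
  \<open>p\<close> it misses exactly the vertex \<open>p - 1\<close>, which accounts for the
  rounding down when \<open>d\<close> and \<open>p\<close> are both odd.\<close>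

definition half_turn_edges :: "nat \<Rightarrow> nat set set" where
  "half_turn_edges p = (\<lambda>i. {i, i + p div 2}) ` {..<p div 2}"

text \<open>No edge is produced twice: if steps \<open>j\<close> and \<open>j'\<close> gave the same
  edge from opposite ends, then \<open>j + j'\<close> would be divisible by \<open>p\<close>, but it
  lies between 2 and \<open>2 * k\<close>.\<close>

lemma card_circulant_edges:
  assumes "2 * k < p"
  shows "card (circulant_edges p k) = p * k"
proof -
  have "inj_on (\<lambda>(i, j). {i, cyc p i j}) ({..<p} \<times> {1..k})"
    using assms by (auto simp: inj_on_def doubleton_eq_iff cyc_def split: if_splits)
  then show ?thesis
    by (simp add: circulant_edges_def card_image card_cartesian_product)
qed

lemma card_half_turn_edges: "card (half_turn_edges p) = p div 2"
proof -
  have "inj_on (\<lambda>i. {i, i + p div 2}) {..<p div 2}"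
    by (auto simp: inj_on_def doubleton_eq_iff)
  then show ?thesis
    by (simp add: half_turn_edges_def card_image)
qed

text \<open>Around the cycle, the ends of a matching edge are \<open>p div 2\<close> apart one way
  and \<open>p - p div 2\<close> the other way. Both distances exceed \<open>k\<close>, the longest
  circulant step.\<close>

lemma circulant_half_turn_disjoint:
  assumes "2 * k + 1 < p"
  shows "circulant_edges p k \<inter> half_turn_edges p = {}"
proof -
  have "k < p div 2" "p div 2 + k < p"
    using assms by linarith+
  then show ?thesis
    by (auto simp: circulant_edges_def half_turn_edges_def doubleton_eq_iff cyc_def
        split: if_splits)
qed

lemma simple_graph_circulant:
  assumes "2 * k < p"
  shows "simple_graph ({..<p}, circulant_edges p k)"
proof -
  have "cyc p i j < p \<and> cyc p i j \<noteq> i" if "i < p" "j \<in> {1..k}" for i j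
    using that assms by (auto simp: cyc_def)
  then have "{i, cyc p i j} \<subseteq> {..<p} \<and> card {i, cyc p i j} = 2"
    if "i < p" "j \<in> {1..k}" for i j
    using that by (metis card_2_iff empty_subsetI insert_subset lessThan_iff)
  then show ?thesis
    unfolding simple_graph_def circulant_edges_def by auto
qed

lemma simple_graph_half_turn: "simple_graph ({..<p}, half_turn_edges p)"
proof -
  have "i + p div 2 < p" if "i < p div 2" for i
    using that by linarith
  then show ?thesis
    by (force simp: simple_graph_def half_turn_edges_def card_insert_if)
qed

text \<open>An edge at \<open>v\<close> is a step of length at most \<open>k\<close> that either
  starts at \<open>v\<close> (family \<open>?A\<close>) or ends there (family \<open>?B\<close>), so
  each family has at most \<open>k\<close> members.\<close>

lemma degree_circulant_le:
  assumes "2 * k < p"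
  shows "degree (V, circulant_edges p k) v \<le> 2 * k"
proof -
  let ?A = "(\<lambda>j. {v, cyc p v j}) ` {1..k}"
  let ?B = "(\<lambda>j. {cyc p v (p - j), v}) ` {1..k}"
  have incident: "{i, cyc p i j} \<in> ?A \<union> ?B"
    if "i < p" "j \<in> {1..k}" "v = i \<or> v = cyc p i j" for i j
    using that(3)
  proof
    assume "v = i"
    with that(2) show ?thesis by blast
  next
    assume v: "v = cyc p i j"
    \<comment> \<open>Going forward by \<open>p - j\<close> undoes a step by
      \<open>j\<close>.\<close>
    have "cyc p (cyc p i j) (p - j) = i"
      using that(1,2) assms by (auto simp: cyc_def)
    then have "{i, cyc p i j} = {cyc p v (p - j), v}"
      by (simp only: v)
    then have "{i, cyc p i j} \<in> ?B"
      using that(2) by (rule image_eqI)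
    then show ?thesis ..
  qed
  have "{e \<in> circulant_edges p k. v \<in> e} \<subseteq> ?A \<union> ?B"
  proof
    fix e assume "e \<in> {e \<in> circulant_edges p k. v \<in> e}"
    then obtain i j where "i < p" "j \<in> {1..k}" "e = {i, cyc p i j}" "v = i \<or> v = cyc p i j"
      by (auto simp: circulant_edges_def)
    then show "e \<in> ?A \<union> ?B" by (simp only: incident)
  qed
  then have "degree (V, circulant_edges p k) v \<le> card (?A \<union> ?B)"
    unfolding degree_def by (simp add: card_mono)
  also have "\<dots> \<le> card ?A + card ?B" by (rule card_Un_le)
  also have "\<dots> \<le> card {1..k} + card {1..k}"
    by (intro add_mono card_image_le) auto
  finally show ?thesis by simp
qed

lemma degree_half_turn_le: "degree (V, half_turn_edges p) v \<le> 1"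
proof -
  \<comment> \<open>Whether \<open>v\<close> lies in the lower half decides which end of the edge it
    can be. The set on the right is only a bound: its member need not be an edge.\<close>
  have "{e \<in> half_turn_edges p. v \<in> e} \<subseteq>
      {if v < p div 2 then {v, v + p div 2} else {v - p div 2, v}}"
    by (auto simp: half_turn_edges_def)
  from card_mono[OF _ this] show ?thesis
    by (simp add: degree_def)
qed

lemma degree_Un_le: "degree (V, E \<union> F) v \<le> degree (V, E) v + degree (V, F) v"
proof -
  have "{e \<in> E \<union> F. v \<in> e} = {e \<in> E. v \<in> e} \<union> {e \<in> F. v \<in> e}" by auto
  then show ?thesis
    by (simp add: degree_def card_Un_le)
qed

lemma near_regular_graph_exists:
  assumes "d < p"
  obtains G :: "nat graph" where "simple_graph G" "card (vertices G) = p"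
    "\<And>v. degree G v \<le> d" "card (edges G) = d * p div 2"
proof (cases "even d")
  case True
  then obtain k where k: "d = 2 * k" by blast
  show thesis
    using assms unfolding k
    by (intro that[of "({..<p}, circulant_edges p k)"])
      (simp_all add: k simple_graph_circulant card_circulant_edges degree_circulant_le)
next
  case False
  then obtain k where k: "d = 2 * k + 1" by (rule oddE)
  define G where "G = ({..<p}, circulant_edges p k \<union> half_turn_edges p)"
  have lt: "2 * k < p" "2 * k + 1 < p"
    using assms k by auto
  have "simple_graph G"
    using simple_graph_circulant[OF lt(1)] simple_graph_half_turn[of p]
    by (auto simp: G_def simple_graph_def)
  moreover have "degree G v \<le> d" for v
    unfolding G_def k
    using degree_Un_le degree_circulant_le[OF lt(1)] degree_half_turn_le
    by (meson add_mono order_trans)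
  moreover have "card (edges G) = d * p div 2"
  proof -
    have "finite (circulant_edges p k)" "finite (half_turn_edges p)"
      by (simp_all add: circulant_edges_def half_turn_edges_def)
    then have "card (edges G) = p * k + p div 2"
      using circulant_half_turn_disjoint[OF lt(2)]
      by (simp add: G_def card_Un_disjoint card_circulant_edges[OF lt(1)] card_half_turn_edges)
    \<comment> \<open>The even summand \<open>p * k * 2\<close> passes through the division exactly,
      so only the matching part is rounded.\<close>
    also have "\<dots> = (p + p * k * 2) div 2" by simp
    also have "p + p * k * 2 = d * p" by (simp add: k algebra_simps)
    finally show ?thesis .
  qed
  ultimately show thesis
    using that[of G] by (simp add: G_def)
qed

section \<open>The extremal number of stars\<close>

text \<open>Here \<open>d\<close> stands for n - 2, the largest degree allowed. This avoids
  truncated subtraction, and \<open>d < p\<close> is the hypothesis that p is at least n -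
  1.\<close>

lemma ex_star:
  assumes "d < p"
  shows "ex p (star (Suc d)) = d * p div 2"
  unfolding ex_def
proof (rule Max_eqI[OF finite_ex_set])
  fix y assume "y \<in> {card (edges G) | G :: nat graph.
     simple_graph G \<and> card (vertices G) = p \<and> \<not> contains G (star (Suc d))}"
  then obtain G :: "nat graph" where G: "y = card (edges G)" "simple_graph G"
    "card (vertices G) = p" "\<not> contains G (star (Suc d))"
    by auto
  then have "degree G v \<le> d" if "v \<in> vertices G" for v
    using that by (auto simp: contains_star_iff not_less_eq_eq)
  then have "(\<Sum>v\<in>vertices G. degree G v) \<le> card (vertices G) * d"
    using sum_bounded_above[of "vertices G" "degree G" d] by simp
  then have "2 * y \<le> d * p"
    using G by (simp add: sum_degree mult.commute)
  \<comment> \<open>Since \<open>y\<close> is an integer, halving the bound on \<open>2 * y\<close>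
    may round down.\<close>
  then show "y \<le> d * p div 2" by linarith
next
  obtain G :: "nat graph" where G: "simple_graph G" "card (vertices G) = p"
    "\<And>v. degree G v \<le> d" "card (edges G) = d * p div 2"
    using near_regular_graph_exists[OF assms] by blast
  then have "\<not> contains G (star (Suc d))"
    by (auto simp: contains_star_iff not_less_eq_eq)
  then show "d * p div 2 \<in> {card (edges G) | G :: nat graph.
     simple_graph G \<and> card (vertices G) = p \<and> \<not> contains G (star (Suc d))}"
    using G by (intro CollectI exI[of _ G]) simp
qed

theorem theorem2p1:
  fixes p n :: nat
  assumes "p > 0" and "n > 0"
    and "p \<ge> n - 1" and "n - 1 \<ge> 1"
  shows "int (ex p (star (n - 1))) = \<lfloor>(real n - 2) * real p / 2\<rfloor>"
proof -
  obtain d where n: "n = Suc (Suc d)"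
    using assms(4) by (intro that[of "n - 2"]) linarith
  have "int (ex p (star (n - 1))) = int (d * p div 2)"
    using assms(3) n by (simp add: ex_star)
  \<comment> \<open>Division of natural numbers is the floor of the real quotient.\<close>
  also have "\<dots> = \<lfloor>real (d * p) / real 2\<rfloor>"
    by (simp only: floor_divide_of_nat_eq)
  also have "real (d * p) / real 2 = (real n - 2) * real p / 2"
    by (simp add: n)
  finally show ?thesis .
qed

end
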